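(* Let $\mathcal{V}$ be a Banach space with $\dim(\mathcal{V})\ge2$ and $T>0$. When $C^{1-var}([0,T],\mathcal{V})$ is equipped with the $2$-variation norm, the area operator $\gamma\mapsto A(\gamma)$ is not continuous and not bounded, even when areas are equipped with the uniform norm $\|\alpha\|_{\infty-var}=\sup_{0\le s<t\le T}\|\alpha(s,t)\|$. In particular, there is no constant $C$ such that $\|A(\gamma)\|_{\infty-var,[0,T]}\le C\|\gamma\|_{2-var,[0,T]}^2$ for all $\gamma\in C^{1-var}([0,T],\mathcal{V})$.
   Context: For $p>0$ and a continuous path $\gamma:[0,T]\to\mathcal{V}$, $\|\gamma\|_{p-var,[0,T]}=(\sup_D\sum_j\|\gamma(t_{j+1})-\gamma(t_j)\|^p)^{1/p}$, the sup being over all finite partitions $D=\{t_j\}$ of $[0,T]$. $C^{1-var}([0,T],\mathcal{V})$ is the set of continuous paths of finite $1$-variation. $\mathcal{V}\otimes\mathcal{V}$ is the completion of the algebraic tensor product in a norm satisfying $\|v\otimes u\|\le\|v\|\|u\|$; $[v_1,v_2]=v_1\otimes v_2-v_2\otimes v_1$; $[\mathcal{V},\mathcal{V}]$ is the closure in $\mathcal V\otimes\mathcal V$ of the span of all $[v_1,v_2]$. For $\gamma\in C^{1-var}([0,T],\mathcal{V})$ the area is the function $A(\gamma)$ on $\{(s,t):0\le s\le t\le T\}$ with values in $[\mathcal V,\mathcal V]$ given by $A(\gamma)(s,t)=\frac12\iint_{s<u_1<u_2<t}[d\gamma(u_1),d\gamma(u_2)]$. The area operator sends $\gamma\in C^{1-var}([0,T],\mathcal{V})$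 to $A(\gamma)$; "bounded" for this quadratic operator means that a bound as in the last sentence of the claim holds. *)

theory Defs
  imports "HOL-Analysis.Analysis"
begin

section \<open>The algebraic tensor product\<close>

text \<open>
  The algebraic tensor product \<open>V \<otimes> V\<close> of a real vector space with itself is realised as in
  R. Ryan, Introduction to Tensor Products of Banach Spaces, Section 1.1: the elementary tensor
  \<open>v \<otimes> u\<close> is the evaluation functional \<open>B \<mapsto> B v u\<close> on the bilinear forms on \<open>V\<close>, and \<open>V \<otimes> V\<close> is
  the space of all finite sums of elementary tensors.  Functionals are set to 0 outside the
  bilinear forms.  The lemmas \<open>tensor_bilinear\<close> and \<open>alg_tensor_universal\<close> below show that this
  has the universal property of the tensor product.
\<close>

typedef (overloaded) 'v alg_tensor =
  "{\<phi> :: ('v::real_vector \<Rightarrow> 'v \<Rightarrow> real) \<Rightarrow> real.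
      \<exists>zs. \<phi> = (\<lambda>B. if bilinear B then \<Sum>(x, y)\<leftarrow>zs. B x y else 0)}"
  by blast

setup_lifting type_definition_alg_tensor

lift_definition tensor :: "'v::real_vector \<Rightarrow> 'v \<Rightarrow> 'v alg_tensor" (infix "\<otimes>" 75)
  is "\<lambda>v u B. if bilinear B then B v u else 0"
  subgoal for v u by (rule exI[of _ "[(v, u)]"]) auto
  done

lemma sum_list_scale_bilinear:
  fixes B :: "'v::real_vector \<Rightarrow> 'v \<Rightarrow> real"
  assumes "bilinear B"
  shows "(\<Sum>(x, y)\<leftarrow>map (\<lambda>(x, y). (c *\<^sub>R x, y)) zs. B x y) = c * (\<Sum>(x, y)\<leftarrow>zs. B x y)"
  by (induction zs) (auto simp: bilinear_lmul[OF assms] algebra_simps)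

instantiation alg_tensor :: (real_vector) real_vector
begin

lift_definition zero_alg_tensor :: "'a alg_tensor" is "\<lambda>B. 0"
  by (rule exI[of _ "[]"]) auto

lift_definition plus_alg_tensor :: "'a alg_tensor \<Rightarrow> 'a alg_tensor \<Rightarrow> 'a alg_tensor"
  is "\<lambda>\<phi> \<psi> B. \<phi> B + \<psi> B"
  subgoal premises prems for \<phi> \<psi>
  proof -
    obtain zs ws where "\<phi> = (\<lambda>B. if bilinear B then \<Sum>(x, y)\<leftarrow>zs. B x y else 0)"
      and "\<psi> = (\<lambda>B. if bilinear B then \<Sum>(x, y)\<leftarrow>ws. B x y else 0)"
      using prems by blast
    then show ?thesis by (intro exI[of _ "zs @ ws"]) auto
  qed
  done

lift_definition scaleR_alg_tensor :: "real \<Rightarrow> 'a alg_tensor \<Rightarrow> 'a alg_tensor"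
  is "\<lambda>c \<phi> B. c * \<phi> B"
  subgoal premises prems for c \<phi>
  proof -
    obtain zs where "\<phi> = (\<lambda>B. if bilinear B then \<Sum>(x, y)\<leftarrow>zs. B x y else 0)"
      using prems by blast
    then show ?thesis
      by (intro exI[of _ "map (\<lambda>(x, y). (c *\<^sub>R x, y)) zs"])
        (auto simp: sum_list_scale_bilinear simp del: map_map)
  qed
  done

definition uminus_alg_tensor :: "'a alg_tensor \<Rightarrow> 'a alg_tensor"
  where "uminus_alg_tensor \<phi> = (-1) *\<^sub>R \<phi>"

definition minus_alg_tensor :: "'a alg_tensor \<Rightarrow> 'a alg_tensor \<Rightarrow> 'a alg_tensor"
  where "minus_alg_tensor \<phi> \<psi> = \<phi> + - \<psi>"

instance
proof
  fix a b c :: "'a alg_tensor" and r s :: real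
  show "a + b + c = a + (b + c)" by transfer (auto simp: algebra_simps)
  show "a + b = b + a" by transfer (auto simp: algebra_simps)
  show "0 + a = a" by transfer auto
  show "- a + a = 0" unfolding uminus_alg_tensor_def by transfer auto
  show "a - b = a + - b" by (simp add: minus_alg_tensor_def)
  show "r *\<^sub>R (a + b) = r *\<^sub>R a + r *\<^sub>R b" by transfer (auto simp: algebra_simps)
  show "(r + s) *\<^sub>R a = r *\<^sub>R a + s *\<^sub>R a" by transfer (auto simp: algebra_simps)
  show "r *\<^sub>R s *\<^sub>R a = (r * s) *\<^sub>R a" by transfer (auto simp: algebra_simps)
  show "1 *\<^sub>R a = a" by transfer auto
qed

end

lemma tensor_bilinear: "bilinear ((\<otimes>) :: 'v::real_vector \<Rightarrow> 'v \<Rightarrow> 'v alg_tensor)"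
  unfolding bilinear_def
  by (intro conjI allI linearI; transfer)
    (auto simp: bilinear_ladd bilinear_radd bilinear_lmul bilinear_rmul fun_eq_iff)

lemma alg_tensor_sum: "\<exists>zs. \<phi> = (\<Sum>(x, y)\<leftarrow>zs. x \<otimes> y)"
proof -
  have *: "Rep_alg_tensor (\<Sum>(x, y)\<leftarrow>zs. x \<otimes> y)
      = (\<lambda>B. if bilinear B then \<Sum>(x, y)\<leftarrow>zs. B x y else 0)" for zs :: "('a \<times> 'a) list"
    by (induction zs)
      (auto simp: zero_alg_tensor.rep_eq plus_alg_tensor.rep_eq tensor.rep_eq fun_eq_iff)
  show ?thesis
    using Rep_alg_tensor[of \<phi>] by (auto simp: *[symmetric] Rep_alg_tensor_inject)
qed

lemma bilinear_linear_compose: "bilinear B \<Longrightarrow> linear f \<Longrightarrow> bilinear (\<lambda>x y. f (B x y))"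
  unfolding bilinear_def by (auto intro: linear_compose[unfolded o_def])

lemma linear_functional_separates:
  fixes x :: "'a::real_vector"
  assumes "x \<noteq> 0"
  shows "\<exists>f::'a \<Rightarrow> real. linear f \<and> f x \<noteq> 0"
proof -
  have "independent {x}" using assms by simp
  then obtain f :: "'a \<Rightarrow> real" where "linear f" "\<forall>y\<in>{x}. f y = 1"
    using linear_independent_extend[of "{x}" "\<lambda>_. 1"] by blast
  then show ?thesis by (intro exI[of _ f]) auto
qed

theorem alg_tensor_universal:
  fixes \<beta> :: "'v::real_vector \<Rightarrow> 'v \<Rightarrow> 'w::real_vector"
  assumes "bilinear \<beta>"
  shows "\<exists>!L. linear L \<and> (\<forall>v u. L (v \<otimes> u) = \<beta> v u)"
proof -
  have lin_sum: "L (\<Sum>(x, y)\<leftarrow>zs. x \<otimes> y) = (\<Sum>(x, y)\<leftarrow>zs. L (x \<otimes> y))"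
    if "linear L" for L :: "'v alg_tensor \<Rightarrow> 'w" and zs
    using that by (induction zs) (auto simp: linear_0 linear_add)
  have rep: "Rep_alg_tensor (\<Sum>(x, y)\<leftarrow>zs. x \<otimes> y) B = (\<Sum>(x, y)\<leftarrow>zs. B x y)"
    if "bilinear B" for zs and B :: "'v \<Rightarrow> 'v \<Rightarrow> real"
    using that by (induction zs)
      (auto simp: zero_alg_tensor.rep_eq plus_alg_tensor.rep_eq tensor.rep_eq)
  define S where "S zs = (\<Sum>(x, y)\<leftarrow>zs. \<beta> x y)" for zs
  have fS: "f (S zs) = Rep_alg_tensor (\<Sum>(x, y)\<leftarrow>zs. x \<otimes> y) (\<lambda>x y. f (\<beta> x y))"
    if f: "linear f" for zs and f :: "'w \<Rightarrow> real"
    unfolding rep[OF bilinear_linear_compose[OF assms f]] S_def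
    using f by (induction zs) (auto simp: linear_0 linear_add)
  have sep: "a = b" if "\<And>f::'w \<Rightarrow> real. linear f \<Longrightarrow> f a = f b" for a b
    using linear_functional_separates[of "a - b"] that by (force simp: linear_diff)
  define L where "L \<phi> = S (SOME zs. \<phi> = (\<Sum>(x, y)\<leftarrow>zs. x \<otimes> y))" for \<phi>
  have fL: "f (L \<phi>) = Rep_alg_tensor \<phi> (\<lambda>x y. f (\<beta> x y))"
    if f: "linear f" for \<phi> and f :: "'w \<Rightarrow> real"
    using someI_ex[OF alg_tensor_sum[of \<phi>]] unfolding L_def fS[OF f] by simp
  show ?thesis
  proof (rule ex1I)
    have "linear L"
    proof (rule linearI)
      show "L (\<phi> + \<psi>) = L \<phi> + L \<psi>" for \<phi> \<psi>
        by (rule sep) (simp add: linear_add fL plus_alg_tensor.rep_eq)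
      show "L (c *\<^sub>R \<phi>) = c *\<^sub>R L \<phi>" for c \<phi>
        by (rule sep) (simp add: linear_scale fL scaleR_alg_tensor.rep_eq)
    qed
    moreover have "L (v \<otimes> u) = \<beta> v u" for v u
      by (rule sep) (simp add: fL tensor.rep_eq bilinear_linear_compose[OF assms])
    ultimately show "linear L \<and> (\<forall>v u. L (v \<otimes> u) = \<beta> v u)" by blast
  next
    fix M assume M: "linear M \<and> (\<forall>v u. M (v \<otimes> u) = \<beta> v u)"
    show "M = L"
    proof
      fix \<phi> :: "'v alg_tensor"
      obtain zs where zs: "\<phi> = (\<Sum>(x, y)\<leftarrow>zs. x \<otimes> y)" using alg_tensor_sum by blast
      have "M \<phi> = S zs" using M by (simp add: zs lin_sum S_def)
      then show "M \<phi> = L \<phi>" by (intro sep) (simp add: fL fS zs)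
    qed
  qed
qed


section \<open>Completions\<close>

definition is_norm :: "('a::real_vector \<Rightarrow> real) \<Rightarrow> bool" where
  "is_norm N \<longleftrightarrow> (\<forall>x. 0 \<le> N x) \<and> (\<forall>x. N x = 0 \<longleftrightarrow> x = 0) \<and>
     (\<forall>x y. N (x + y) \<le> N x + N y) \<and> (\<forall>c x. N (c *\<^sub>R x) = \<bar>c\<bar> * N x)"

text \<open>
  The completion of a normed space is unique only up to isometric isomorphism, so it is described
  as a Banach space into which the normed space embeds isometrically with dense range.
\<close>

definition is_completion :: "('a::real_vector \<Rightarrow> real) \<Rightarrow> ('a \<Rightarrow> 'w::banach) \<Rightarrow> bool" where
  "is_completion N \<iota> \<longleftrightarrow> linear \<iota> \<and> (\<forall>x. norm (\<iota> x) = N x) \<and> closure (range \<iota>) = UNIV"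

definition bracket :: "('v::real_vector alg_tensor \<Rightarrow> 'w::banach) \<Rightarrow> 'v \<Rightarrow> 'v \<Rightarrow> 'w" where
  "bracket \<iota> v u = \<iota> (v \<otimes> u - u \<otimes> v)"

definition bracket_space :: "('v::real_vector alg_tensor \<Rightarrow> 'w::banach) \<Rightarrow> 'w set" where
  "bracket_space \<iota> = closure (span {bracket \<iota> v u |v u. True})"


section \<open>Variation norms\<close>

definition is_partition :: "real \<Rightarrow> real \<Rightarrow> nat \<Rightarrow> (nat \<Rightarrow> real) \<Rightarrow> bool" where
  "is_partition a b n t \<longleftrightarrow> t 0 = a \<and> t n = b \<and> (\<forall>j<n. t j < t (Suc j))"

definition variation_sums :: "real \<Rightarrow> real \<Rightarrow> real \<Rightarrow> (real \<Rightarrow> 'v::real_normed_vector) \<Rightarrow> real set" where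
  "variation_sums p a b \<gamma> =
     {\<Sum>j<n. norm (\<gamma> (t (Suc j)) - \<gamma> (t j)) powr p |n t. is_partition a b n t}"

text \<open>Only meaningful if the sums are bounded; see \<open>bdd_above_variation_sums\<close> for \<open>C1var\<close>.\<close>

definition var_norm :: "real \<Rightarrow> real \<Rightarrow> real \<Rightarrow> (real \<Rightarrow> 'v::real_normed_vector) \<Rightarrow> real" where
  "var_norm p a b \<gamma> = Sup (variation_sums p a b \<gamma>) powr (1 / p)"

text \<open>Paths are total functions, of which only the values on \<open>[0, T]\<close> are ever used.\<close>

definition C1var :: "real \<Rightarrow> (real \<Rightarrow> 'v::real_normed_vector) set" where
  "C1var T = {\<gamma>. continuous_on {0..T} \<gamma> \<and> bdd_above (variation_sums 1 0 T \<gamma>)}"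

lemma bdd_above_variation_sums:
  assumes "bdd_above (variation_sums 1 a b \<gamma>)" and "1 \<le> p"
  shows "bdd_above (variation_sums p a b \<gamma>)"
proof -
  obtain M where M: "\<And>x. x \<in> variation_sums 1 a b \<gamma> \<Longrightarrow> x \<le> M"
    using assms(1) by (auto simp: bdd_above_def)
  have "(\<Sum>j<n. norm (\<gamma> (t (Suc j)) - \<gamma> (t j)) powr p) \<le> M * M powr (p - 1)"
    if t: "is_partition a b n t" for n t
  proof -
    let ?d = "\<lambda>j. norm (\<gamma> (t (Suc j)) - \<gamma> (t j))"
    have sum: "(\<Sum>j<n. ?d j) \<le> M"
      by (rule M) (use t in \<open>auto simp: variation_sums_def\<close>)
    have "?d j powr p \<le> ?d j * M powr (p - 1)" if "j < n" for j
    proof -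
      have "?d j \<le> M"
        using member_le_sum[of j "{..<n}" ?d] that sum by auto
      then have "?d j powr 1 * ?d j powr (p - 1) \<le> ?d j powr 1 * M powr (p - 1)"
        using assms(2) by (intro mult_left_mono powr_mono2) auto
      then show ?thesis by (simp add: powr_mult_base)
    qed
    then have "(\<Sum>j<n. ?d j powr p) \<le> (\<Sum>j<n. ?d j) * M powr (p - 1)"
      unfolding sum_distrib_right by (intro sum_mono) auto
    also have "\<dots> \<le> M * M powr (p - 1)"
      using sum by (intro mult_right_mono) auto
    finally show ?thesis .
  qed
  then show ?thesis by (auto simp: bdd_above_def variation_sums_def)
qed

lemma C1var_diff:
  assumes "\<gamma> \<in> C1var T" and "\<eta> \<in> C1var T"
  shows "(\<lambda>u. \<eta> u - \<gamma> u) \<in> C1var T"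
proof -
  obtain M K where M: "\<And>x. x \<in> variation_sums 1 0 T \<gamma> \<Longrightarrow> x \<le> M"
    and K: "\<And>x. x \<in> variation_sums 1 0 T \<eta> \<Longrightarrow> x \<le> K"
    using assms by (auto simp: C1var_def bdd_above_def)
  have "(\<Sum>j<n. norm ((\<eta> (t (Suc j)) - \<gamma> (t (Suc j))) - (\<eta> (t j) - \<gamma> (t j)))) \<le> K + M"
    if t: "is_partition 0 T n t" for n t
  proof -
    have "(\<Sum>j<n. norm ((\<eta> (t (Suc j)) - \<gamma> (t (Suc j))) - (\<eta> (t j) - \<gamma> (t j))))
        \<le> (\<Sum>j<n. norm (\<eta> (t (Suc j)) - \<eta> (t j)) + norm (\<gamma> (t (Suc j)) - \<gamma> (t j)))"
      by (intro sum_mono order_trans[OF _ norm_triangle_ineq4]) (simp add: algebra_simps)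
    also have "\<dots> \<le> K + M"
      unfolding sum.distrib
      by (intro add_mono K M) (use t in \<open>auto simp: variation_sums_def\<close>)
    finally show ?thesis .
  qed
  then show ?thesis
    using assms by (auto simp: C1var_def bdd_above_def variation_sums_def intro!: continuous_on_diff)
qed


section \<open>The area of a path\<close>

text \<open>
  The Riemann--Stieltjes integral of \<open>\<beta> (f u) (dg u)\<close> over \<open>[a, b]\<close> for a bilinear \<open>\<beta>\<close>:
  the limit of the tagged sums as the mesh of the partition tends to 0.
\<close>

definition has_rs_integral ::
    "('x \<Rightarrow> 'v::real_normed_vector \<Rightarrow> 'w::real_normed_vector) \<Rightarrow> (real \<Rightarrow> 'x) \<Rightarrow> (real \<Rightarrow> 'v) \<Rightarrow>
     real \<Rightarrow> real \<Rightarrow> 'w \<Rightarrow> bool" where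
  "has_rs_integral \<beta> f g a b I \<longleftrightarrow>
     (\<forall>\<epsilon>>0. \<exists>\<delta>>0. \<forall>n t \<tau>. is_partition a b n t \<and>
        (\<forall>j<n. t (Suc j) - t j < \<delta> \<and> \<tau> j \<in> {t j..t (Suc j)}) \<longrightarrow>
        norm ((\<Sum>j<n. \<beta> (f (\<tau> j)) (g (t (Suc j)) - g (t j))) - I) < \<epsilon>)"

definition rs_integral ::
    "('x \<Rightarrow> 'v::real_normed_vector \<Rightarrow> 'w::real_normed_vector) \<Rightarrow> (real \<Rightarrow> 'x) \<Rightarrow> (real \<Rightarrow> 'v) \<Rightarrow>
     real \<Rightarrow> real \<Rightarrow> 'w" where
  "rs_integral \<beta> f g a b = (THE I. has_rs_integral \<beta> f g a b I)"

text \<open>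
  The double integral over \<open>s < u\<^sub>1 < u\<^sub>2 < t\<close> is iterated, with the inner integral
  \<open>\<integral> d\<gamma>(u\<^sub>1)\<close> over \<open>[s, u\<^sub>2]\<close>.
\<close>

definition area ::
    "('v::real_normed_vector alg_tensor \<Rightarrow> 'w::banach) \<Rightarrow> (real \<Rightarrow> 'v) \<Rightarrow> real \<Rightarrow> real \<Rightarrow> 'w" where
  "area \<iota> \<gamma> s t = (1/2) *\<^sub>R
     rs_integral (bracket \<iota>) (\<lambda>u\<^sub>2. rs_integral (*\<^sub>R) (\<lambda>u\<^sub>1. 1) \<gamma> s u\<^sub>2) \<gamma> s t"

definition uniform_norm :: "real \<Rightarrow> (real \<Rightarrow> real \<Rightarrow> 'w::real_normed_vector) \<Rightarrow> ennreal" where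
  "uniform_norm T \<alpha> = (SUP (s, t) \<in> {(s, t). 0 \<le> s \<and> s < t \<and> t \<le> T}. ennreal (norm (\<alpha> s t)))"

definition area_operator_continuous ::
    "('v::real_normed_vector alg_tensor \<Rightarrow> 'w::banach) \<Rightarrow> real \<Rightarrow> bool" where
  "area_operator_continuous \<iota> T \<longleftrightarrow>
     (\<forall>\<gamma>\<in>C1var T. \<forall>\<epsilon>>0. \<exists>\<delta>>0. \<forall>\<eta>\<in>C1var T.
        var_norm 2 0 T (\<lambda>u. \<eta> u - \<gamma> u) < \<delta> \<longrightarrow>
        uniform_norm T (\<lambda>s t. area \<iota> \<eta> s t - area \<iota> \<gamma> s t) < ennreal \<epsilon>)"

lemma partition_mesh_exists:
  assumes "a \<le> b" and "0 < \<delta>"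
  shows "\<exists>n t. is_partition a b n t \<and> (\<forall>j<n. t (Suc j) - t j < \<delta>)"
proof (cases "a = b")
  case True
  then show ?thesis by (intro exI[of _ 0] exI[of _ "\<lambda>_. a"]) (auto simp: is_partition_def)
next
  case False
  then have ab: "a < b" using assms by simp
  obtain n :: nat where n: "(b - a) / \<delta> < real n" using reals_Archimedean2 by blast
  have "0 < (b - a) / \<delta>" using ab assms(2) by simp
  then have n0: "0 < real n" using n by linarith
  have step: "a + real (Suc j) * ((b - a) / n) - (a + real j * ((b - a) / n)) = (b - a) / n" for j
    by (simp add: algebra_simps add_divide_distrib diff_divide_distrib)
  have small: "(b - a) / n < \<delta>" and pos: "0 < (b - a) / n"
    using n n0 ab assms(2) by (auto simp: field_simps)
  define t where "t j = a + real j * ((b - a) / n)" for j :: nat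
  have t: "t (Suc j) - t j = (b - a) / n" for j
    using step by (simp add: t_def)
  have "t j < t (Suc j)" and "t (Suc j) - t j < \<delta>" for j
    using t[of j] pos small by linarith+
  moreover have "t 0 = a" and "t n = b"
    using n0 by (auto simp: t_def)
  ultimately show ?thesis
    by (intro exI[of _ n] exI[of _ t]) (auto simp: is_partition_def)
qed

lemma has_rs_integral_unique:
  assumes "a \<le> b" and I: "has_rs_integral \<beta> f g a b I" and J: "has_rs_integral \<beta> f g a b J"
  shows "I = J"
proof (rule ccontr)
  assume "I \<noteq> J"
  then have e: "0 < norm (I - J) / 2" by simp
  obtain d1 where d1: "d1 > 0" "\<And>n t \<tau>. is_partition a b n t \<Longrightarrow>
      (\<forall>j<n. t (Suc j) - t j < d1 \<and> \<tau> j \<in> {t j..t (Suc j)}) \<Longrightarrow>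
      norm ((\<Sum>j<n. \<beta> (f (\<tau> j)) (g (t (Suc j)) - g (t j))) - I) < norm (I - J) / 2"
    using I[unfolded has_rs_integral_def, rule_format, OF e] by blast
  obtain d2 where d2: "d2 > 0" "\<And>n t \<tau>. is_partition a b n t \<Longrightarrow>
      (\<forall>j<n. t (Suc j) - t j < d2 \<and> \<tau> j \<in> {t j..t (Suc j)}) \<Longrightarrow>
      norm ((\<Sum>j<n. \<beta> (f (\<tau> j)) (g (t (Suc j)) - g (t j))) - J) < norm (I - J) / 2"
    using J[unfolded has_rs_integral_def, rule_format, OF e] by blast
  obtain n t where t: "is_partition a b n t" "\<forall>j<n. t (Suc j) - t j < min d1 d2"
    using partition_mesh_exists[OF assms(1), of "min d1 d2"] d1(1) d2(1) by auto
  let ?S = "\<Sum>j<n. \<beta> (f (t j)) (g (t (Suc j)) - g (t j))"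
  have "norm (?S - I) < norm (I - J) / 2"
    by (rule d1(2)[OF t(1)]) (use t in \<open>auto simp: is_partition_def intro: less_imp_le\<close>)
  moreover have "norm (?S - J) < norm (I - J) / 2"
    by (rule d2(2)[OF t(1)]) (use t in \<open>auto simp: is_partition_def intro: less_imp_le\<close>)
  ultimately show False
    using norm_triangle_ineq4[of "?S - J" "?S - I"] by simp
qed

lemma rs_integral_eqI: "a \<le> b \<Longrightarrow> has_rs_integral \<beta> f g a b I \<Longrightarrow> rs_integral \<beta> f g a b = I"
  unfolding rs_integral_def by (rule the_equality) (auto intro: has_rs_integral_unique)

lemma rs_integral_one:
  assumes "a \<le> b"
  shows "rs_integral (*\<^sub>R) (\<lambda>_. 1) \<gamma> a b = \<gamma> b - \<gamma> a"
  by (rule rs_integral_eqI[OF assms])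
    (auto simp: has_rs_integral_def is_partition_def sum_lessThan_telescope[of "\<lambda>j. \<gamma> (_ j)"]
      intro!: exI[of _ 1])

lemma area_in_bracket_space:
  assumes "s \<le> t"
    and I: "has_rs_integral (bracket \<iota>) (\<lambda>u\<^sub>2. rs_integral (*\<^sub>R) (\<lambda>u\<^sub>1. 1) \<gamma> s u\<^sub>2) \<gamma> s t I"
  shows "area \<iota> \<gamma> s t \<in> bracket_space \<iota>"
proof -
  let ?f = "\<lambda>u\<^sub>2. rs_integral (*\<^sub>R) (\<lambda>u\<^sub>1. 1::real) \<gamma> s u\<^sub>2"
  let ?S = "span {bracket \<iota> v u |v u. True}"
  have "(1/2) *\<^sub>R I \<in> closure ?S"
    unfolding closure_approachable
  proof (intro allI impI)
    fix e :: real assume e: "0 < e"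
    obtain d where d: "d > 0" "\<And>n p \<tau>. is_partition s t n p \<Longrightarrow>
        (\<forall>j<n. p (Suc j) - p j < d \<and> \<tau> j \<in> {p j..p (Suc j)}) \<Longrightarrow>
        norm ((\<Sum>j<n. bracket \<iota> (?f (\<tau> j)) (\<gamma> (p (Suc j)) - \<gamma> (p j))) - I) < e"
      using I[unfolded has_rs_integral_def, rule_format, OF e] by blast
    obtain n p where p: "is_partition s t n p" "\<forall>j<n. p (Suc j) - p j < d"
      using partition_mesh_exists[OF assms(1) d(1)] by blast
    let ?R = "\<Sum>j<n. bracket \<iota> (?f (p j)) (\<gamma> (p (Suc j)) - \<gamma> (p j))"
    have "norm (?R - I) < e"
      by (rule d(2)[OF p(1)]) (use p in \<open>auto simp: is_partition_def intro: less_imp_le\<close>)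
    moreover have "norm ((1/2) *\<^sub>R ?R - (1/2) *\<^sub>R I) \<le> norm (?R - I)"
      by (simp flip: scaleR_diff_right)
    ultimately have "dist ((1/2) *\<^sub>R ?R) ((1/2) *\<^sub>R I) < e" by (simp add: dist_norm)
    moreover have "(1/2) *\<^sub>R ?R \<in> ?S"
      by (intro span_scale span_sum) (auto intro!: span_base)
    ultimately show "\<exists>y\<in>?S. dist y ((1/2) *\<^sub>R I) < e" by blast
  qed
  then show ?thesis
    by (simp add: area_def bracket_space_def rs_integral_eqI[OF assms])
qed

end

theory Submission
  imports Defs
begin

text \<open>
  The lacunary paths \<open>\<gamma>\<^sub>n(u) = \<Sum>k<n. 2\<^sup>-\<^sup>k (cos(4\<^sup>k \<omega> u) v + sin(4\<^sup>k \<omega> u) w)\<close> with \<open>\<omega> = 2\<pi>/T\<close> are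
  \<open>1/2\<close>-Hoelder uniformly in \<open>n\<close>, so their \<open>2\<close>-variations stay bounded.  Different frequencies are
  orthogonal and each of the \<open>n\<close> loops contributes \<open>\<pi> [v, w]\<close>, so the area over \<open>[0, T]\<close> is
  \<open>n \<pi> [v, w]\<close>.  Shrinking \<open>v\<close> and \<open>w\<close> turns unboundedness into discontinuity at the zero path.
\<close>

section \<open>Riemann-Stieltjes integrals against differentiable paths\<close>

lemma partition_in_interval:
  assumes t: "is_partition a b n t" and j: "j < n"
  shows "a \<le> t j" "t j < t (Suc j)" "t (Suc j) \<le> b"
proof -
  have mono: "t i \<le> t k" if "i \<le> k" "k \<le> n" for i k
    using that
  proof (induction k rule: dec_induct)
    case (step m)
    then have "t m < t (Suc m)" using t by (simp add: is_partition_def)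
    then show ?case using step by simp
  qed simp
  show "t j < t (Suc j)" using t j by (simp add: is_partition_def)
  show "a \<le> t j" using mono[of 0 j] t j by (simp add: is_partition_def)
  show "t (Suc j) \<le> b" using mono[of "Suc j" n] t j by (simp add: is_partition_def)
qed

lemma partition_sum_lengths:
  assumes "is_partition a b n t"
  shows "(\<Sum>j<n. t (Suc j) - t j) = b - a"
  using assms by (simp add: sum_lessThan_telescope is_partition_def)

text \<open>With the tag frozen on one partition interval,
  \<open>\<beta> (f (\<tau> j)) (g u) - \<Phi> u\<close> has derivative
  \<open>\<beta> (f (\<tau> j) - f u) (g' u)\<close>. Uniform continuity of \<open>f\<close> makes
  this small for fine partitions, so the mean value inequality bounds the error on each interval by
  a small multiple of its length, and the lengths sum to \<open>b - a\<close>.\<close>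

lemma has_rs_integral_antiderivative:
  fixes f :: "real \<Rightarrow> 'x::real_normed_vector" and g :: "real \<Rightarrow> 'v::real_normed_vector"
    and \<beta> :: "'x \<Rightarrow> 'v \<Rightarrow> 'w::real_normed_vector"
  assumes "bounded_bilinear \<beta>" and "a \<le> b" and f: "continuous_on {a..b} f"
    and g: "\<And>u. u \<in> {a..b} \<Longrightarrow> (g has_vector_derivative g' u) (at u within {a..b})"
    and M: "\<And>u. u \<in> {a..b} \<Longrightarrow> norm (g' u) \<le> M"
    and \<Phi>: "\<And>u. u \<in> {a..b} \<Longrightarrow> (\<Phi> has_vector_derivative \<beta> (f u) (g' u)) (at u within {a..b})"
  shows "has_rs_integral \<beta> f g a b (\<Phi> b - \<Phi> a)"
  unfolding has_rs_integral_def
proof (intro allI impI)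
  interpret bounded_bilinear \<beta> by fact
  fix \<epsilon> :: real assume \<epsilon>: "0 < \<epsilon>"
  obtain K where K: "0 < K" "\<And>x y. norm (\<beta> x y) \<le> norm x * norm y * K"
    using pos_bounded by blast
  have M0: "0 \<le> M" using assms(2) by (intro order_trans[OF norm_ge_zero M[of a]]) simp
  \<comment> \<open>Chosen so that the total error \<open>e * M * K * (b - a)\<close> stays below
    \<epsilon>. The added ones keep the denominator positive and the final estimate strict when
    \<open>M = 0\<close> or \<open>a = b\<close>.\<close>
  define e where "e = \<epsilon> / (K * (M + 1) * (b - a + 1))"
  have e: "0 < e" unfolding e_def using K M0 assms(2) \<epsilon> by (intro divide_pos_pos mult_pos_pos) auto
  have "uniformly_continuous_on {a..b} f"
    using f by (intro compact_uniformly_continuous) auto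
  then obtain \<delta> where \<delta>: "0 < \<delta>"
    and uc: "\<And>u u'. u \<in> {a..b} \<Longrightarrow> u' \<in> {a..b} \<Longrightarrow> dist u' u < \<delta> \<Longrightarrow> dist (f u') (f u) < e"
    using e by (rule uniformly_continuous_onE) blast
  show "\<exists>\<delta>>0. \<forall>n t \<tau>. is_partition a b n t \<and>
        (\<forall>j<n. t (Suc j) - t j < \<delta> \<and> \<tau> j \<in> {t j..t (Suc j)}) \<longrightarrow>
        norm ((\<Sum>j<n. \<beta> (f (\<tau> j)) (g (t (Suc j)) - g (t j))) - (\<Phi> b - \<Phi> a)) < \<epsilon>"
  proof (intro exI[of _ \<delta>] conjI \<delta> allI impI, elim conjE)
    fix n t \<tau>
    assume t: "is_partition a b n t"
      and fine: "\<forall>j<n. t (Suc j) - t j < \<delta> \<and> \<tau> j \<in> {t j..t (Suc j)}"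
    have step: "norm (\<beta> (f (\<tau> j)) (g (t (Suc j)) - g (t j)) - (\<Phi> (t (Suc j)) - \<Phi> (t j)))
        \<le> e * M * K * (t (Suc j) - t j)" if j: "j < n" for j
    proof -
      note tj = partition_in_interval[OF t j]
      let ?S = "{t j..t (Suc j)}" and ?h = "\<lambda>u. \<beta> (f (\<tau> j)) (g u) - \<Phi> u"
      have sub: "?S \<subseteq> {a..b}" using tj by auto
      have "norm (?h (t (Suc j)) - ?h (t j)) \<le> e * M * K * norm (t (Suc j) - t j)"
      proof (rule differentiable_bound[where S = ?S
            and f' = "\<lambda>u d. d *\<^sub>R (\<beta> (f (\<tau> j)) (g' u) - \<beta> (f u) (g' u))"])
        fix u assume u: "u \<in> ?S"
        then have u': "u \<in> {a..b}" and \<tau>: "\<tau> j \<in> {a..b}" and "\<tau> j \<in> ?S"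
          using sub fine j by auto
        have "dist (\<tau> j) u \<le> t (Suc j) - t j"
          using u \<open>\<tau> j \<in> ?S\<close> by (simp add: dist_real_def abs_le_iff)
        also have "\<dots> < \<delta>" using fine j by blast
        finally have "dist (\<tau> j) u < \<delta>" .
        then have d: "norm (f (\<tau> j) - f u) \<le> e"
          using uc[OF u' \<tau>] by (simp add: dist_norm)
        have "((\<lambda>u. \<beta> (f (\<tau> j)) (g u)) has_vector_derivative \<beta> (f (\<tau> j)) (g' u)) (at u within {a..b})"
          by (rule bounded_linear.has_vector_derivative[OF bounded_linear_right g[OF u']])
        then have "(?h has_vector_derivative \<beta> (f (\<tau> j)) (g' u) - \<beta> (f u) (g' u))
            (at u within {a..b})"
          by (intro has_vector_derivative_diff \<Phi>[OF u'])
        then show "(?h has_derivative (\<lambda>d. d *\<^sub>R (\<beta> (f (\<tau> j)) (g' u) - \<beta> (f u) (g' u)))) (at u within ?S)"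
          unfolding has_vector_derivative_def using sub by (rule has_derivative_subset)
        have "norm (\<beta> (f (\<tau> j) - f u) (g' u)) \<le> norm (f (\<tau> j) - f u) * norm (g' u) * K"
          by (rule K)
        also have "\<dots> \<le> e * M * K"
          using d M[OF u'] e K(1) by (intro mult_right_mono mult_mono) auto
        finally have "norm (\<beta> (f (\<tau> j)) (g' u) - \<beta> (f u) (g' u)) \<le> e * M * K"
          by (simp only: diff_left)
        then show "onorm (\<lambda>d. d *\<^sub>R (\<beta> (f (\<tau> j)) (g' u) - \<beta> (f u) (g' u))) \<le> e * M * K"
          using e M0 K(1) by (intro onorm_bound) (simp_all add: mult.commute mult_left_mono)
      qed (use tj in auto)
      then show ?thesis using tj(2) by (simp add: diff_right algebra_simps)
    qed
    have "(\<Sum>j<n. \<Phi> (t (Suc j)) - \<Phi> (t j)) = \<Phi> b - \<Phi> a"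
      using t sum_lessThan_telescope[of "\<lambda>j. \<Phi> (t j)" n] by (simp add: is_partition_def)
    then have "norm ((\<Sum>j<n. \<beta> (f (\<tau> j)) (g (t (Suc j)) - g (t j))) - (\<Phi> b - \<Phi> a))
        = norm (\<Sum>j<n. \<beta> (f (\<tau> j)) (g (t (Suc j)) - g (t j)) - (\<Phi> (t (Suc j)) - \<Phi> (t j)))"
      by (simp add: sum_subtractf)
    also have "\<dots> \<le> (\<Sum>j<n. e * M * K * (t (Suc j) - t j))"
      by (rule sum_norm_le) (use step in auto)
    also have "\<dots> = e * M * K * (b - a)"
      by (simp only: partition_sum_lengths[OF t] flip: sum_distrib_left)
    also have "\<dots> \<le> e * K * M * (b - a + 1)"
      using e K(1) M0 by (simp add: algebra_simps)
    also have "\<dots> < e * K * (M + 1) * (b - a + 1)"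
      using e K(1) M0 assms(2) by (intro mult_strict_right_mono mult_strict_left_mono) auto
    also have "\<dots> = \<epsilon>"
      using K(1) M0 assms(2) by (simp add: e_def)
    finally show "norm ((\<Sum>j<n. \<beta> (f (\<tau> j)) (g (t (Suc j)) - g (t j))) - (\<Phi> b - \<Phi> a)) < \<epsilon>" .
  qed
qed

section \<open>The bracket in the completed tensor product\<close>

text \<open>The cross-norm inequality applies to both terms of the commutator, which gives the
  constant 2. Boundedness is what lets the antiderivative criterion be applied to bracket-valued
  integrals.\<close>

lemma bounded_bilinear_bracket:
  fixes N :: "'v::real_normed_vector alg_tensor \<Rightarrow> real" and \<iota> :: "'v alg_tensor \<Rightarrow> 'w::banach"
  assumes norm: "is_norm N" and cross: "\<And>v u. N (v \<otimes> u) \<le> norm v * norm u"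
    and completion: "is_completion N \<iota>"
  shows "bounded_bilinear (bracket \<iota>)"
proof
  have \<iota>: "linear \<iota>" "\<And>x. norm (\<iota> x) = N x" using completion by (auto simp: is_completion_def)
  note tb = tensor_bilinear
  show "bracket \<iota> (a + a') b = bracket \<iota> a b + bracket \<iota> a' b" for a a' b
    by (simp add: bracket_def bilinear_ladd[OF tb] bilinear_radd[OF tb] linear_add[OF \<iota>(1)]
        linear_diff[OF \<iota>(1)])
  show "bracket \<iota> a (b + b') = bracket \<iota> a b + bracket \<iota> a b'" for a b b'
    by (simp add: bracket_def bilinear_ladd[OF tb] bilinear_radd[OF tb] linear_add[OF \<iota>(1)]
        linear_diff[OF \<iota>(1)])
  show "bracket \<iota> (r *\<^sub>R a) b = r *\<^sub>R bracket \<iota> a b" for r a b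
    by (simp add: bracket_def bilinear_lmul[OF tb] bilinear_rmul[OF tb] linear_scale[OF \<iota>(1)]
        linear_diff[OF \<iota>(1)] algebra_simps)
  show "bracket \<iota> a (r *\<^sub>R b) = r *\<^sub>R bracket \<iota> a b" for r a b
    by (simp add: bracket_def bilinear_lmul[OF tb] bilinear_rmul[OF tb] linear_scale[OF \<iota>(1)]
        linear_diff[OF \<iota>(1)] algebra_simps)
  have "norm (bracket \<iota> a b) \<le> norm a * norm b * 2" for a b
    using norm_triangle_ineq4[of "\<iota> (a \<otimes> b)" "\<iota> (b \<otimes> a)"] cross[of a b] cross[of b a]
    by (simp add: bracket_def linear_diff[OF \<iota>(1)] \<iota>(2) mult.commute)
  then show "\<exists>K. \<forall>a b. norm (bracket \<iota> a b) \<le> norm a * norm b * K" by blast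
qed

lemma bracket_self: "linear \<iota> \<Longrightarrow> bracket \<iota> v v = 0"
  by (simp add: bracket_def linear_0)

lemma bracket_swap: "linear \<iota> \<Longrightarrow> bracket \<iota> w v = - bracket \<iota> v w"
  by (simp add: bracket_def linear_diff)

text \<open>Let \<open>f\<close>, \<open>g\<close> be linear functionals dual to \<open>v\<close>,
  \<open>w\<close>. Tensors are functionals on bilinear forms, and the form \<open>f x * g y\<close>
  takes the value 1 on \<open>v \<otimes> w\<close> and 0 on \<open>w \<otimes> v\<close>, so the
  commutator is nonzero. It stays nonzero in the completion because \<open>N\<close> is definite and
  \<iota> is isometric.\<close>

lemma bracket_nonzero:
  fixes v w :: "'v::real_vector"
  assumes "is_norm N" and "is_completion N \<iota>" and ind: "independent {v, w}" and "v \<noteq> w"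
  shows "bracket \<iota> v w \<noteq> 0"
proof
  obtain f :: "'v \<Rightarrow> real" where f: "linear f" "f v = 1" "f w = 0"
    using linear_independent_extend[OF ind, of "\<lambda>x. if x = v then 1 else 0"] \<open>v \<noteq> w\<close> by auto
  obtain g :: "'v \<Rightarrow> real" where g: "linear g" "g v = 0" "g w = 1"
    using linear_independent_extend[OF ind, of "\<lambda>x. if x = w then 1 else 0"] \<open>v \<noteq> w\<close> by auto
  let ?B = "\<lambda>x y. f x * g y"
  have "bilinear ?B"
    unfolding bilinear_def
    by (auto intro!: linearI simp: linear_add[OF f(1)] linear_add[OF g(1)]
        linear_scale[OF f(1)] linear_scale[OF g(1)] algebra_simps)
  then have "Rep_alg_tensor (v \<otimes> w) ?B \<noteq> Rep_alg_tensor (w \<otimes> v) ?B"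
    by (simp add: tensor.rep_eq f g)
  then have "v \<otimes> w - w \<otimes> v \<noteq> 0" by auto
  then have "N (v \<otimes> w - w \<otimes> v) \<noteq> 0" using assms(1) by (simp add: is_norm_def)
  moreover assume "bracket \<iota> v w = 0"
  ultimately show False
    using assms(2) unfolding is_completion_def bracket_def by (metis norm_zero)
qed

section \<open>Lacunary paths and their Hoelder continuity\<close>

text \<open>
  The sum doubles its scale when the first term is split off, and \<open>5 * d - d\<^sup>2\<close>, continued by the
  trivial bound 4 for \<open>d > 1\<close>, is a supersolution of the resulting recursion.
\<close>

lemma lacunary_sum_bound:
  fixes d :: real
  assumes "0 \<le> d"
  shows "(\<Sum>k<n. min 2 (4 ^ k * d\<^sup>2) / 2 ^ k) \<le> 5 * d"
proof -
  define S where "S n d = (\<Sum>k<n. min 2 (4 ^ k * d\<^sup>2) / 2 ^ k)" for n and d :: real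
  have rec: "S (Suc n) d = min 2 (d\<^sup>2) + S n (2 * d) / 2" for n d
    unfolding S_def sum.lessThan_Suc_shift
    by (simp add: sum_divide_distrib power_mult_distrib mult_ac)
  have "S n d \<le> (if d \<le> 1 then 5 * d - d\<^sup>2 else 4)" if "0 \<le> d" for d
    using that
  proof (induction n arbitrary: d)
    case 0
    then have "d * d \<le> 5 * d" if "d \<le> 1" using that by (intro mult_right_mono) auto
    then show ?case by (simp add: S_def power2_eq_square)
  next
    case (Suc n)
    have IH: "S n (2 * d) \<le> (if 2 * d \<le> 1 then 5 * (2 * d) - (2 * d)\<^sup>2 else 4)"
      using Suc.prems by (intro Suc.IH) simp
    \<comment> \<open>The cases follow the scales of \<open>d\<close> and \<open>2 * d\<close>. In
      the first, the recursion reproduces \<open>5 * d - d\<^sup>2\<close> exactly; in the second,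
      the required inequality factors as \<open>0 \<le> (2 * d - 1) * (2 - d)\<close>; in the third,
      the bound is \<open>2 + 4 / 2 = 4\<close>.\<close>
    consider "2 * d \<le> 1" | "1 < 2 * d" "d \<le> 1" | "1 < d" by linarith
    then show ?case
    proof cases
      case 1
      then show ?thesis using IH by (simp add: rec power_mult_distrib)
    next
      case 2
      have "0 \<le> (2 * d - 1) * (2 - d)" using 2 by (intro mult_nonneg_nonneg) auto
      then have "d\<^sup>2 + 2 \<le> 5 * d - d\<^sup>2" by (simp add: algebra_simps power2_eq_square)
      then show ?thesis using IH 2 by (simp add: rec)
    next
      case 3
      then show ?thesis using IH by (simp add: rec)
    qed
  qed
  from this[OF assms] have "S n d \<le> (if d \<le> 1 then 5 * d - d\<^sup>2 else 4)" .
  also have "\<dots> \<le> 5 * d" by simp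
  finally show ?thesis by (simp add: S_def)
qed

lemma abs_sin_diff_le: "\<bar>sin a - sin b\<bar> \<le> min 2 \<bar>a - b\<bar>" for a b :: real
proof -
  have "\<bar>sin a - sin b\<bar> = 2 * \<bar>sin ((a - b) / 2)\<bar> * \<bar>cos ((a + b) / 2)\<bar>"
    by (simp add: sin_diff_sin abs_mult)
  also have "\<dots> \<le> 2 * \<bar>sin ((a - b) / 2)\<bar> * 1" by (intro mult_left_mono) auto
  also have "\<dots> \<le> \<bar>a - b\<bar>" using abs_sin_x_le_abs_x[of "(a - b) / 2"] by simp
  finally show ?thesis using abs_sin_le_one[of a] abs_sin_le_one[of b] by linarith
qed

lemma abs_cos_diff_le: "\<bar>cos a - cos b\<bar> \<le> min 2 \<bar>a - b\<bar>" for a b :: real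
  using abs_sin_diff_le[of "pi / 2 - a" "pi / 2 - b"] by (simp add: sin_diff abs_minus_commute)

text \<open>The amplitude \<open>1 / 2 ^ k\<close> is the inverse square root of
  \<open>4 ^ k\<close>, the critical scaling for Hoelder exponent 1/2: a circle of radius
  \<open>1 / 2 ^ k\<close> traversed \<open>4 ^ k\<close> times sweeps out an area that does not
  depend on \<open>k\<close>.\<close>

definition lacunary_cos :: "real \<Rightarrow> nat \<Rightarrow> real \<Rightarrow> real" where
  "lacunary_cos \<omega> n u = (\<Sum>k<n. cos (4 ^ k * \<omega> * u) / 2 ^ k)"

definition lacunary_sin :: "real \<Rightarrow> nat \<Rightarrow> real \<Rightarrow> real" where
  "lacunary_sin \<omega> n u = (\<Sum>k<n. sin (4 ^ k * \<omega> * u) / 2 ^ k)"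

definition lacunary_path :: "real \<Rightarrow> nat \<Rightarrow> 'v::real_vector \<Rightarrow> 'v \<Rightarrow> real \<Rightarrow> 'v" where
  "lacunary_path \<omega> n v w u = lacunary_cos \<omega> n u *\<^sub>R v + lacunary_sin \<omega> n u *\<^sub>R w"

text \<open>With \<open>d = sqrt (\<omega> * (t - s))\<close> the increment of the term of index
  \<open>k\<close> is at most \<open>min 2 (4 ^ k * d\<^sup>2) / 2 ^ k\<close>: the Lipschitz bound
  serves low frequencies, the bound 2 high ones. A general \<open>F\<close> covers sine and cosine
  at once, and the constant 5 is independent of \<open>n\<close>.\<close>

lemma lacunary_trig_hoelder:
  fixes F :: "real \<Rightarrow> real"
  assumes F: "\<And>a b. \<bar>F a - F b\<bar> \<le> min 2 \<bar>a - b\<bar>" and "0 < \<omega>" and "s \<le> t"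
  shows "\<bar>(\<Sum>k<n. F (4 ^ k * \<omega> * t) / 2 ^ k) - (\<Sum>k<n. F (4 ^ k * \<omega> * s) / 2 ^ k)\<bar>
    \<le> 5 * sqrt (\<omega> * (t - s))"
proof -
  have "\<bar>\<Sum>k<n. F (4 ^ k * \<omega> * t) / 2 ^ k - F (4 ^ k * \<omega> * s) / 2 ^ k\<bar>
      \<le> (\<Sum>k<n. min 2 (4 ^ k * (sqrt (\<omega> * (t - s)))\<^sup>2) / 2 ^ k)"
  proof (intro order_trans[OF sum_abs] sum_mono)
    fix k
    have "4 ^ k * \<omega> * t - 4 ^ k * \<omega> * s = 4 ^ k * (\<omega> * (t - s))" by (simp add: algebra_simps)
    then have "\<bar>F (4 ^ k * \<omega> * t) - F (4 ^ k * \<omega> * s)\<bar> \<le> min 2 (4 ^ k * (\<omega> * (t - s)))"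
      using F[of "4 ^ k * \<omega> * t" "4 ^ k * \<omega> * s"] assms by simp
    then show "\<bar>F (4 ^ k * \<omega> * t) / 2 ^ k - F (4 ^ k * \<omega> * s) / 2 ^ k\<bar>
        \<le> min 2 (4 ^ k * (sqrt (\<omega> * (t - s)))\<^sup>2) / 2 ^ k"
      using assms by (simp add: divide_right_mono flip: diff_divide_distrib)
  qed
  also have "\<dots> \<le> 5 * sqrt (\<omega> * (t - s))"
    using assms by (intro lacunary_sum_bound) simp
  finally show ?thesis by (simp add: sum_subtractf)
qed

lemma lacunary_path_hoelder:
  fixes v w :: "'v::real_normed_vector"
  assumes "0 < \<omega>" and "s \<le> t"
  shows "norm (lacunary_path \<omega> n v w t - lacunary_path \<omega> n v w s)
    \<le> 5 * sqrt (\<omega> * (t - s)) * (norm v + norm w)"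
proof -
  let ?c = "lacunary_cos \<omega> n t - lacunary_cos \<omega> n s"
  let ?s = "lacunary_sin \<omega> n t - lacunary_sin \<omega> n s"
  have "lacunary_path \<omega> n v w t - lacunary_path \<omega> n v w s = ?c *\<^sub>R v + ?s *\<^sub>R w"
    by (simp add: lacunary_path_def algebra_simps)
  then have "norm (lacunary_path \<omega> n v w t - lacunary_path \<omega> n v w s)
      \<le> \<bar>?c\<bar> * norm v + \<bar>?s\<bar> * norm w"
    using norm_triangle_ineq[of "?c *\<^sub>R v" "?s *\<^sub>R w"] by simp
  also have "\<dots> \<le> 5 * sqrt (\<omega> * (t - s)) * norm v + 5 * sqrt (\<omega> * (t - s)) * norm w"
    unfolding lacunary_cos_def lacunary_sin_def
    by (intro add_mono mult_right_mono lacunary_trig_hoelder abs_sin_diff_le abs_cos_diff_le assms)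
      auto
  finally show ?thesis by (simp add: algebra_simps)
qed

section \<open>Variation of Hoelder continuous and of Lipschitz paths\<close>

text \<open>Squaring turns the 1/2-Hoelder bound into \<open>C\<^sup>2\<close> times the interval
  length, and the lengths add up to \<open>T\<close> for every partition.\<close>

lemma var_norm_2_hoelder:
  assumes "0 < T" and "0 \<le> C"
    and H: "\<And>s t. 0 \<le> s \<Longrightarrow> s \<le> t \<Longrightarrow> t \<le> T \<Longrightarrow> norm (\<gamma> t - \<gamma> s) \<le> C * sqrt (t - s)"
  shows "0 \<le> var_norm 2 0 T \<gamma>" and "var_norm 2 0 T \<gamma> \<le> C * sqrt T"
proof -
  show "0 \<le> var_norm 2 0 T \<gamma>" by (simp add: var_norm_def)
  have upper: "x \<le> C\<^sup>2 * T" if x: "x \<in> variation_sums 2 0 T \<gamma>" for x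
  proof -
    obtain n t where t: "is_partition 0 T n t"
      and sum: "x = (\<Sum>j<n. norm (\<gamma> (t (Suc j)) - \<gamma> (t j)) powr 2)"
      using x unfolding variation_sums_def by blast
    have "x \<le> (\<Sum>j<n. C\<^sup>2 * (t (Suc j) - t j))"
      unfolding sum
    proof (rule sum_mono)
      fix j assume "j \<in> {..<n}"
      then have tj: "0 \<le> t j" "t j < t (Suc j)" "t (Suc j) \<le> T"
        using partition_in_interval[OF t, of j] by auto
      then have "(norm (\<gamma> (t (Suc j)) - \<gamma> (t j)))\<^sup>2 \<le> (C * sqrt (t (Suc j) - t j))\<^sup>2"
        by (intro power_mono H) auto
      then show "norm (\<gamma> (t (Suc j)) - \<gamma> (t j)) powr 2 \<le> C\<^sup>2 * (t (Suc j) - t j)"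
        using tj by (simp add: power_mult_distrib)
    qed
    also have "\<dots> = C\<^sup>2 * T"
      by (simp only: partition_sum_lengths[OF t] flip: sum_distrib_left) simp
    finally show ?thesis .
  qed
  \<comment> \<open>The real \<open>Sup\<close> is controlled only for a nonempty bounded set, and
    its nonnegativity is needed to read the power \<open>1 / 2\<close> as a square root.\<close>
  have ne: "variation_sums 2 0 T \<gamma> \<noteq> {}"
    using partition_mesh_exists[of 0 T 1] assms(1) by (auto simp: variation_sums_def)
  then obtain x where x: "x \<in> variation_sums 2 0 T \<gamma>" by blast
  then have "0 \<le> x" by (auto simp: variation_sums_def intro!: sum_nonneg)
  also have "x \<le> Sup (variation_sums 2 0 T \<gamma>)"
    using x upper by (intro cSup_upper) (auto simp: bdd_above_def)
  finally have "0 \<le> Sup (variation_sums 2 0 T \<gamma>)" .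
  moreover have "Sup (variation_sums 2 0 T \<gamma>) \<le> C\<^sup>2 * T"
    using ne upper by (rule cSup_least)
  ultimately have "var_norm 2 0 T \<gamma> \<le> sqrt (C\<^sup>2 * T)"
    by (simp add: var_norm_def powr_half_sqrt)
  then show "var_norm 2 0 T \<gamma> \<le> C * sqrt T"
    using assms(2) by (simp add: real_sqrt_mult)
qed

text \<open>The mean value inequality makes the path Lipschitz with constant \<open>M\<close>, so
  every 1-variation sum is at most \<open>M * T\<close>.\<close>

lemma C1var_if_bounded_derivative:
  assumes \<gamma>: "\<And>u. (\<gamma> has_vector_derivative \<gamma>' u) (at u)" and M: "\<And>u. norm (\<gamma>' u) \<le> M"
  shows "\<gamma> \<in> C1var T"
proof -
  have lip: "norm (\<gamma> t - \<gamma> s) \<le> M * norm (t - s)" for s t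
  proof (rule differentiable_bound[where S = UNIV and f' = "\<lambda>u d. d *\<^sub>R \<gamma>' u"])
    show "onorm (\<lambda>d. d *\<^sub>R \<gamma>' u) \<le> M" for u
      using M[of u] order_trans[OF norm_ge_zero M[of u]]
      by (intro onorm_bound) (simp_all add: mult.commute[of M] mult_left_mono)
  qed (use \<gamma> in \<open>auto simp: has_vector_derivative_def\<close>)
  have "(\<Sum>j<n. norm (\<gamma> (t (Suc j)) - \<gamma> (t j)) powr 1) \<le> M * T" if t: "is_partition 0 T n t" for n t
  proof -
    have "(\<Sum>j<n. norm (\<gamma> (t (Suc j)) - \<gamma> (t j)) powr 1) \<le> (\<Sum>j<n. M * (t (Suc j) - t j))"
    proof (rule sum_mono)
      fix j assume "j \<in> {..<n}"
      then have "t j < t (Suc j)" using t by (simp add: is_partition_def)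
      then show "norm (\<gamma> (t (Suc j)) - \<gamma> (t j)) powr 1 \<le> M * (t (Suc j) - t j)"
        using lip[of "t (Suc j)" "t j"] by simp
    qed
    also have "\<dots> = M * T"
      by (simp only: partition_sum_lengths[OF t] flip: sum_distrib_left) simp
    finally show ?thesis .
  qed
  moreover have "continuous_on {0..T} \<gamma>"
    using \<gamma> by (intro continuous_at_imp_continuous_on) (auto intro: has_vector_derivative_continuous)
  ultimately show ?thesis
    by (auto simp: C1var_def variation_sums_def bdd_above_def)
qed

section \<open>Derivatives and area of the lacunary paths\<close>

lemma lacunary_cos_deriv:
  "(lacunary_cos \<omega> n has_real_derivative - (\<Sum>k<n. 2 ^ k * \<omega> * sin (4 ^ k * \<omega> * u))) (at u within S)"
proof -
  have "(4::real) ^ k = 2 ^ k * 2 ^ k" for k by (simp flip: power_mult_distrib)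
  then show ?thesis
    unfolding lacunary_cos_def[abs_def]
    by (auto intro!: derivative_eq_intros sum.cong simp flip: sum_negf)
qed

lemma lacunary_sin_deriv:
  "(lacunary_sin \<omega> n has_real_derivative (\<Sum>k<n. 2 ^ k * \<omega> * cos (4 ^ k * \<omega> * u))) (at u within S)"
proof -
  have "(4::real) ^ k = 2 ^ k * 2 ^ k" for k by (simp flip: power_mult_distrib)
  then show ?thesis
    unfolding lacunary_sin_def[abs_def]
    by (auto intro!: derivative_eq_intros sum.cong)
qed

lemma lacunary_path_deriv:
  fixes v w :: "'v::real_normed_vector"
  shows "(lacunary_path \<omega> n v w has_vector_derivative
       ((\<Sum>k<n. 2 ^ k * \<omega> * cos (4 ^ k * \<omega> * u)) *\<^sub>R w
         - (\<Sum>k<n. 2 ^ k * \<omega> * sin (4 ^ k * \<omega> * u)) *\<^sub>R v)) (at u)"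
  unfolding lacunary_path_def[abs_def]
  by (auto intro!: derivative_eq_intros lacunary_cos_deriv lacunary_sin_deriv)

text \<open>For nonzero \<omega> the bound grows with \<open>n\<close>. It is used for fixed
  \<open>n\<close> only, to place the path in \<open>C1var\<close> and to supply the derivative
  bound for the Riemann-Stieltjes integral.\<close>

lemma lacunary_path_deriv_bound:
  fixes v w :: "'v::real_normed_vector"
  shows "norm ((\<Sum>k<n. 2 ^ k * \<omega> * cos (4 ^ k * \<omega> * u)) *\<^sub>R w
         - (\<Sum>k<n. 2 ^ k * \<omega> * sin (4 ^ k * \<omega> * u)) *\<^sub>R v)
    \<le> (\<Sum>k<n. 2 ^ k * \<bar>\<omega>\<bar>) * (norm v + norm w)"
proof -
  let ?c = "\<Sum>k<n. 2 ^ k * \<omega> * cos (4 ^ k * \<omega> * u)"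
  let ?s = "\<Sum>k<n. 2 ^ k * \<omega> * sin (4 ^ k * \<omega> * u)"
  let ?L = "\<Sum>k<n. 2 ^ k * \<bar>\<omega>\<bar>"
  have "\<bar>?c\<bar> \<le> ?L" "\<bar>?s\<bar> \<le> ?L"
    by (intro order_trans[OF sum_abs] sum_mono; simp add: abs_mult mult_left_le)+
  then have "norm (?c *\<^sub>R w) + norm (?s *\<^sub>R v) \<le> ?L * norm w + ?L * norm v"
    by (simp add: add_mono mult_right_mono)
  also have "\<dots> = ?L * (norm v + norm w)" by (simp only: distrib_left add.commute)
  finally show ?thesis by (rule order_trans[OF norm_triangle_ineq4])
qed

text \<open>Writing \<open>x\<close>, \<open>y\<close> for the lacunary cosine and sine, the
  derivative is \<open>(x - x0) * y' - (y - y0) * x'\<close>, the density of twice the signed area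
  seen from \<open>(x0, y0)\<close>. In the expanded product, equal frequencies leave the constant
  \<omega>, while distinct ones leave an oscillation at their difference, whose primitive is a
  sine.\<close>

lemma lacunary_area_antiderivative:
  assumes \<omega>: "\<omega> \<noteq> 0"
  shows "((\<lambda>u. (\<Sum>j<n. \<Sum>k<n. if j = k then \<omega> * u
                else 2 ^ k / 2 ^ j * sin ((4 ^ j - 4 ^ k) * \<omega> * u) / (4 ^ j - 4 ^ k))
              - x0 * lacunary_sin \<omega> n u + y0 * lacunary_cos \<omega> n u) has_real_derivative
     (lacunary_cos \<omega> n u - x0) * (\<Sum>k<n. 2 ^ k * \<omega> * cos (4 ^ k * \<omega> * u))
       + (lacunary_sin \<omega> n u - y0) * (\<Sum>k<n. 2 ^ k * \<omega> * sin (4 ^ k * \<omega> * u))) (at u within S)"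
proof -
  let ?c = "\<Sum>k<n. 2 ^ k * \<omega> * cos (4 ^ k * \<omega> * u)" and ?s = "\<Sum>k<n. 2 ^ k * \<omega> * sin (4 ^ k * \<omega> * u)"
  have ne: "(4::real) ^ j - 4 ^ k \<noteq> 0" if "j \<noteq> k" for j k :: nat
    using that by (simp add: power_inject_exp)
  have D: "((\<lambda>u. if j = k then \<omega> * u
        else 2 ^ k / 2 ^ j * sin ((4 ^ j - 4 ^ k) * \<omega> * u) / (4 ^ j - 4 ^ k)) has_real_derivative
      2 ^ k / 2 ^ j * \<omega> * cos ((4 ^ j - 4 ^ k) * \<omega> * u)) (at u within S)" for j k
  proof (cases "j = k")
    case True
    then show ?thesis by (auto intro!: derivative_eq_intros)
  next
    case False
    then show ?thesis using ne[OF False] by (auto intro!: derivative_eq_intros)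
  qed
  \<comment> \<open>For each pair of modes, the subtraction formula for the cosine merges the
    product of cosines with the product of sines.\<close>
  have "lacunary_cos \<omega> n u * ?c + lacunary_sin \<omega> n u * ?s
      = (\<Sum>j<n. \<Sum>k<n. 2 ^ k / 2 ^ j * \<omega> * cos ((4 ^ j - 4 ^ k) * \<omega> * u))"
    unfolding lacunary_cos_def lacunary_sin_def sum_product sum.distrib[symmetric]
    by (intro sum.cong refl) (simp add: left_diff_distrib cos_diff field_simps)
  then show ?thesis
    by (auto intro!: derivative_eq_intros lacunary_cos_deriv lacunary_sin_deriv D
        simp: algebra_simps)
qed

text \<open>The inner integral is the increment of the path from 0, and antisymmetry of the bracket
  reduces the integrand to a scalar multiple of \<open>bracket \<iota> v w\<close> with an explicit
  primitive.\<close>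

lemma area_lacunary_path:
  fixes N :: "'v::real_normed_vector alg_tensor \<Rightarrow> real" and \<iota> :: "'v alg_tensor \<Rightarrow> 'w::banach"
  assumes norm: "is_norm N" and cross: "\<And>v u. N (v \<otimes> u) \<le> norm v * norm u"
    and completion: "is_completion N \<iota>" and T: "0 < T"
  shows "area \<iota> (lacunary_path (2 * pi / T) n v w) 0 T = (real n * pi) *\<^sub>R bracket \<iota> v w"
proof -
  interpret bounded_bilinear "bracket \<iota>" by (rule bounded_bilinear_bracket[OF assms(1-3)])
  have lin: "linear \<iota>" using completion by (simp add: is_completion_def)
  define \<omega> where "\<omega> = 2 * pi / T"
  have \<omega>: "\<omega> \<noteq> 0" "\<omega> * T = 2 * pi" using T by (auto simp: \<omega>_def)
  let ?\<gamma> = "lacunary_path \<omega> n v w" and ?x = "lacunary_cos \<omega> n" and ?y = "lacunary_sin \<omega> n"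
  let ?c = "\<lambda>u. \<Sum>k<n. 2 ^ k * \<omega> * cos (4 ^ k * \<omega> * u)"
  let ?s = "\<lambda>u. \<Sum>k<n. 2 ^ k * \<omega> * sin (4 ^ k * \<omega> * u)"
  let ?f = "\<lambda>u\<^sub>2. rs_integral (*\<^sub>R) (\<lambda>u\<^sub>1. 1::real) ?\<gamma> 0 u\<^sub>2"
  define \<phi> where "\<phi> u = (\<Sum>j<n. \<Sum>k<n. if j = k then \<omega> * u
                else 2 ^ k / 2 ^ j * sin ((4 ^ j - 4 ^ k) * \<omega> * u) / (4 ^ j - 4 ^ k))
              - ?x 0 * ?y u + ?y 0 * ?x u" for u
  note deriv = lacunary_path_deriv[of \<omega> n v w]
  have "has_rs_integral (bracket \<iota>) ?f ?\<gamma> 0 T (\<phi> T *\<^sub>R bracket \<iota> v w - \<phi> 0 *\<^sub>R bracket \<iota> v w)"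
  proof (rule has_rs_integral_antiderivative[OF bounded_bilinear_axioms])
    show "continuous_on {0..T} ?f"
    \<comment> \<open>The inner integral is evaluated by \<open>rs_integral_one\<close> only for
      nonnegative upper limit, so continuity is transferred from the increment on
      \<open>{0..T}\<close>.\<close>
    proof (rule continuous_on_eq)
      show "continuous_on {0..T} (\<lambda>u. ?\<gamma> u - ?\<gamma> 0)"
        using deriv by (intro continuous_intros continuous_at_imp_continuous_on)
          (auto intro: has_vector_derivative_continuous)
    qed (simp add: rs_integral_one)
    fix u assume u: "u \<in> {0..T}"
    show "(?\<gamma> has_vector_derivative (?c u *\<^sub>R w - ?s u *\<^sub>R v)) (at u within {0..T})"
      using deriv by (rule has_vector_derivative_at_within)
    have "bracket \<iota> (?f u) (?c u *\<^sub>R w - ?s u *\<^sub>R v)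
        = bracket \<iota> ((?x u - ?x 0) *\<^sub>R v + (?y u - ?y 0) *\<^sub>R w) (?c u *\<^sub>R w - ?s u *\<^sub>R v)"
      using u by (simp add: rs_integral_one lacunary_path_def algebra_simps)
    also have "\<dots> = ((?x u - ?x 0) * ?c u + (?y u - ?y 0) * ?s u) *\<^sub>R bracket \<iota> v w"
      by (simp add: add_left diff_right scaleR_left scaleR_right bracket_self[OF lin]
          bracket_swap[OF lin, of w v] scaleR_add_left mult.commute)
    finally have integrand: "bracket \<iota> (?f u) (?c u *\<^sub>R w - ?s u *\<^sub>R v) = \<dots>" .
    have "(\<phi> has_vector_derivative ((?x u - ?x 0) * ?c u + (?y u - ?y 0) * ?s u)) (at u within {0..T})"
      unfolding \<phi>_def has_real_derivative_iff_has_vector_derivative[symmetric]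
      by (rule lacunary_area_antiderivative[OF \<omega>(1)])
    then show "((\<lambda>u. \<phi> u *\<^sub>R bracket \<iota> v w) has_vector_derivative
        bracket \<iota> (?f u) (?c u *\<^sub>R w - ?s u *\<^sub>R v)) (at u within {0..T})"
      unfolding integrand
      by (rule bounded_linear.has_vector_derivative[OF bounded_linear_scaleR_left])
  qed (use T lacunary_path_deriv_bound in auto)
  then have "rs_integral (bracket \<iota>) ?f ?\<gamma> 0 T = (\<phi> T - \<phi> 0) *\<^sub>R bracket \<iota> v w"
    using T by (simp add: rs_integral_eqI scaleR_diff_left)
  \<comment> \<open>All frequencies and their differences are integer multiples of \<omega>, and
    \<open>\<omega> * T = 2 * pi\<close>. Hence the off-diagonal sines vanish at both ends, the base
    point terms return to their initial values, and each of the \<open>n\<close> diagonal terms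
    gains \<open>2 * pi\<close>; the factor 1/2 in \<open>area\<close> halves the total.\<close>
  moreover have "\<phi> T - \<phi> 0 = 2 * (real n * pi)"
  proof -
    have period: "m * \<omega> * T = 2 * pi * m" for m using \<omega>(2) by (simp add: mult_ac)
    have int: "(4::real) ^ k \<in> \<int>" "(4::real) ^ j - 4 ^ k \<in> \<int>" for j k :: nat by auto
    have "?x T = ?x 0" "?y T = ?y 0"
      by (simp_all add: lacunary_cos_def lacunary_sin_def period int cos_integer_2pi sin_integer_2pi)
    then show ?thesis
      by (simp add: \<phi>_def period int sin_integer_2pi \<omega>(2) if_distrib cong: if_cong)
  qed
  ultimately show ?thesis
    by (simp add: area_def \<omega>_def)
qed

text \<open>The factor \<open>sqrt T\<close> from the 2-variation estimate cancels against the
  frequency \<open>2 * pi / T\<close>, so the bound depends on neither \<open>n\<close> nor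
  \<open>T\<close>. The lower bound allows the estimate to be squared later.\<close>

lemma lacunary_path_var_norm:
  assumes "0 < T"
  shows "0 \<le> var_norm 2 0 T (lacunary_path (2 * pi / T) n v w)"
    and "var_norm 2 0 T (lacunary_path (2 * pi / T) n v w) \<le> 5 * sqrt (2 * pi) * (norm v + norm w)"
proof -
  let ?\<gamma> = "lacunary_path (2 * pi / T) n v w" and ?C = "5 * sqrt (2 * pi / T) * (norm v + norm w)"
  have H: "norm (?\<gamma> t - ?\<gamma> s) \<le> ?C * sqrt (t - s)" if "0 \<le> s" "s \<le> t" "t \<le> T" for s t
    using lacunary_path_hoelder[of "2 * pi / T" s t n v w] that assms
    by (simp only: real_sqrt_mult mult_ac) simp
  have C: "0 \<le> ?C" using assms by (intro mult_nonneg_nonneg add_nonneg_nonneg) auto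
  note var = var_norm_2_hoelder[OF assms C H]
  show "0 \<le> var_norm 2 0 T ?\<gamma>" by (rule var)
  have "sqrt (2 * pi / T) * sqrt T = sqrt (2 * pi)"
    using assms by (simp flip: real_sqrt_mult)
  then have "?C * sqrt T = 5 * sqrt (2 * pi) * (norm v + norm w)"
    by (simp only: mult.assoc mult.commute[of "norm v + norm w"]) (simp flip: mult.assoc)
  with var(2) show "var_norm 2 0 T ?\<gamma> \<le> 5 * sqrt (2 * pi) * (norm v + norm w)"
    by (rule ord_le_eq_trans)
qed

lemma lacunary_path_C1var: "lacunary_path \<omega> n v w \<in> C1var T"
  by (rule C1var_if_bounded_derivative[OF lacunary_path_deriv lacunary_path_deriv_bound])

section \<open>Failure of continuity and of boundedness\<close>

lemma norm_le_uniform_norm: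
  "0 \<le> s \<Longrightarrow> s < t \<Longrightarrow> t \<le> T \<Longrightarrow> ennreal (norm (\<alpha> s t)) \<le> uniform_norm T \<alpha>"
  unfolding uniform_norm_def by (rule SUP_upper2[of "(s, t)"]) auto

text \<open>Every Riemann-Stieltjes sum against the zero path vanishes. Continuity is refuted at
  this path.\<close>

lemma area_zero:
  assumes "linear \<iota>" and "s \<le> t"
  shows "area \<iota> (\<lambda>_. 0) s t = 0"
proof -
  have "bracket \<iota> x 0 = 0" for x
    by (simp add: bracket_def bilinear_lzero bilinear_rzero tensor_bilinear linear_0[OF assms(1)])
  then have "has_rs_integral (bracket \<iota>) f (\<lambda>_. 0) s t 0" for f :: "real \<Rightarrow> _"
    by (auto simp: has_rs_integral_def intro: exI[of _ 1])
  then show ?thesis using assms(2) by (simp add: area_def rs_integral_eqI)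
qed

theorem mainTheorem5:
  fixes N :: "'v::banach alg_tensor \<Rightarrow> real"
    and \<iota> :: "'v alg_tensor \<Rightarrow> 'w::banach"
    and T :: real
  assumes dim: "\<exists>B::'v set. independent B \<and> card B = 2"
    and T: "0 < T"
    and norm: "is_norm N"
    and cross: "\<And>v u. N (v \<otimes> u) \<le> norm v * norm u"
    and completion: "is_completion N \<iota>"
  shows "\<not> area_operator_continuous \<iota> T \<and>
    \<not> (\<exists>C::real. \<forall>\<gamma>\<in>C1var T.
         uniform_norm T (area \<iota> \<gamma>) \<le> ennreal (C * (var_norm 2 0 T \<gamma>)\<^sup>2))"
proof
  interpret bounded_bilinear "bracket \<iota>" by (rule bounded_bilinear_bracket[OF norm cross completion])
  have lin: "linear \<iota>" using completion by (simp add: is_completion_def)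
  obtain v w :: 'v where vw: "independent {v, w}" "v \<noteq> w"
    using dim by (auto simp: card_2_iff)
  define b where "b = norm (bracket \<iota> v w)"
  have b: "0 < b" using bracket_nonzero[OF norm completion vw] by (simp add: b_def)
  let ?\<gamma> = "lacunary_path (2 * pi / T)"
  define K where "K = 5 * sqrt (2 * pi) * (norm v + norm w)"
  have K: "0 \<le> K" unfolding K_def by (intro mult_nonneg_nonneg add_nonneg_nonneg) auto
  \<comment> \<open>Scaling both vectors by \<open>c\<close> scales the variation bound by
    \<open>c\<close> and the area by \<open>c\<^sup>2\<close>, while \<open>n\<close> enters only
    the area.\<close>
  have var: "var_norm 2 0 T (?\<gamma> n (c *\<^sub>R v) (c *\<^sub>R w)) \<le> c * K" if "0 \<le> c" for n c
    using lacunary_path_var_norm(2)[OF T, of n "c *\<^sub>R v" "c *\<^sub>R w"] that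
    by (simp add: K_def algebra_simps)
  have area: "norm (area \<iota> (?\<gamma> n (c *\<^sub>R v) (c *\<^sub>R w)) 0 T) = real n * pi * c\<^sup>2 * b" for n c
    by (simp add: area_lacunary_path[OF norm cross completion T] scaleR_left scaleR_right b_def
        power2_eq_square abs_mult)
  show "\<not> area_operator_continuous \<iota> T"
  proof
    assume cont: "area_operator_continuous \<iota> T"
    have "(\<lambda>_. 0) \<in> (C1var T :: (real \<Rightarrow> 'v) set)"
      by (rule C1var_if_bounded_derivative[where \<gamma>' = "\<lambda>_. 0" and M = 0]) auto
    from cont[unfolded area_operator_continuous_def, rule_format, OF this zero_less_one]
    obtain \<delta> where \<delta>: "0 < \<delta>"
      and close: "\<And>\<eta>::real \<Rightarrow> 'v. \<eta> \<in> C1var T \<Longrightarrow> var_norm 2 0 T \<eta> < \<delta> \<Longrightarrow>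
        uniform_norm T (\<lambda>s t. area \<iota> \<eta> s t - area \<iota> (\<lambda>_. 0) s t) < ennreal 1"
      by auto
    \<comment> \<open>Makes the 2-variation smaller than \<delta> for all \<open>n\<close>
      simultaneously; \<open>n\<close> is then taken so large that the area exceeds the tolerance
      1.\<close>
    define c where "c = \<delta> / (K + 1)"
    have c: "0 < c" "c * K < \<delta>" using \<delta> K by (auto simp: c_def field_simps)
    obtain n :: nat where n: "1 / (pi * c\<^sup>2 * b) < real n" using reals_Archimedean2 by blast
    let ?\<eta> = "?\<gamma> n (c *\<^sub>R v) (c *\<^sub>R w)"
    have "ennreal (norm (area \<iota> ?\<eta> 0 T - area \<iota> (\<lambda>_. 0) 0 T))
        \<le> uniform_norm T (\<lambda>s t. area \<iota> ?\<eta> s t - area \<iota> (\<lambda>_. 0) s t)"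
      using T by (intro norm_le_uniform_norm) auto
    also have "\<dots> < ennreal 1"
      using var[of c n] c by (intro close lacunary_path_C1var) simp
    finally have "real n * pi * c\<^sup>2 * b < 1"
      using T by (simp add: area_zero[OF lin] area)
    moreover have "1 < real n * pi * c\<^sup>2 * b"
      using n b c(1) by (simp add: field_simps)
    ultimately show False by simp
  qed
  show "\<not> (\<exists>C::real. \<forall>\<gamma>\<in>C1var T.
         uniform_norm T (area \<iota> \<gamma>) \<le> ennreal (C * (var_norm 2 0 T \<gamma>)\<^sup>2))"
  proof
    assume "\<exists>C::real. \<forall>\<gamma>\<in>C1var T.
         uniform_norm T (area \<iota> \<gamma>) \<le> ennreal (C * (var_norm 2 0 T \<gamma>)\<^sup>2)"
    then obtain C :: real where C: "\<And>\<gamma>. \<gamma> \<in> C1var T \<Longrightarrow>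
         uniform_norm T (area \<iota> \<gamma>) \<le> ennreal (C * (var_norm 2 0 T \<gamma>)\<^sup>2)"
      by blast
    obtain n :: nat where n: "\<bar>C\<bar> * K\<^sup>2 / (pi * b) < real n" using reals_Archimedean2 by blast
    let ?\<eta> = "?\<gamma> n v w"
    have "ennreal (real n * pi * b) = ennreal (norm (area \<iota> ?\<eta> 0 T))"
      using area[of n 1] by simp
    also have "\<dots> \<le> uniform_norm T (area \<iota> ?\<eta>)"
      using T by (intro norm_le_uniform_norm) auto
    also have "\<dots> \<le> ennreal (C * (var_norm 2 0 T ?\<eta>)\<^sup>2)"
      by (intro C lacunary_path_C1var)
    \<comment> \<open>Passing to \<open>\<bar>C\<bar>\<close> covers a negative \<open>C\<close>,
      which \<open>ennreal\<close> would truncate to 0, and gives the nonnegative right-hand side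
      needed to return to a real inequality.\<close>
    also have "\<dots> \<le> ennreal (\<bar>C\<bar> * K\<^sup>2)"
      using var[of 1 n] lacunary_path_var_norm(1)[OF T, of n v w]
      by (intro ennreal_leI mult_mono power_mono) auto
    finally have "real n * pi * b \<le> \<bar>C\<bar> * K\<^sup>2" by (subst (asm) ennreal_le_iff) auto
    moreover have "\<bar>C\<bar> * K\<^sup>2 < real n * pi * b" using n b by (simp add: field_simps)
    ultimately show False by simp
  qed
qed

end
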